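(* Let $a<b$ be real numbers, let $x\in(a,b)$, and let $f,g:[a,b]\rightarrow\mathbb{R}$ be continuous on $[a,b]$ and differentiable on $(a,b)\setminus\{x\}$. If $g'(t)\neq 0$ for $t\in(a,x)\cup(x,b)$, then $$\left\vert f(x)-\frac{1}{b-a}\int_a^b f(t)\,dt\right\vert\leq\frac{1}{b-a}\left\vert g(x)(x-a)-\int_a^x g(t)\,dt\right\vert\cdot\left\Vert\frac{f'}{g'}\right\Vert_{(a,x),\infty}+\frac{1}{b-a}\left\vert g(x)(b-x)-\int_x^b g(t)\,dt\right\vert\cdot\left\Vert\frac{f'}{g'}\right\Vert_{(x,b),\infty}.$$
   Context: For an open interval $J$, $\left\Vert\frac{f'}{g'}\right\Vert_{J,\infty}:=\sup_{t\in J}\left\vert\frac{f'(t)}{g'(t)}\right\vert\in[0,\infty]$. If one of these suprema is $+\infty$, the right-hand side is understood as $+\infty$ (so the inequality is trivial). *)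

theory Defs
  imports "HOL-Analysis.Analysis"
begin

(* The supremum is taken in the extended reals, so it is \<infinity> exactly when h is unbounded on J.
   The library convention 0 * \<infinity> = 0 plays no role when such a norm is multiplied by
   \<bar>g x * (x - a) - integral {a..x} g\<bar> or \<bar>g x * (b - x) - integral {x..b} g\<bar>: if g is continuous
   with nonvanishing derivative inside the interval, these factors are positive. *)
definition sup_norm_on :: "real set \<Rightarrow> (real \<Rightarrow> real) \<Rightarrow> ereal" where
  "sup_norm_on J h = (SUP t\<in>J. ereal \<bar>h t\<bar>)"

end

theory Submission imports Defs begin

text \<open>
  Write \<open>f x * (b - a) - \<integral>f\<close> as the sum of the deviations \<open>\<integral>(f x - f t) dt\<close> over \<open>[a, x]\<close> and over
  \<open>[x, b]\<close>; it then suffices to treat one interval \<open>[u, v]\<close> with a distinguished endpoint \<open>c\<close>.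
  There Cauchy's mean value theorem bounds \<open>\<bar>f c - f t\<bar>\<close> by \<open>M * \<bar>g c - g t\<bar>\<close>, where \<open>M\<close> is the
  supremum of \<open>\<bar>f' / g'\<bar>\<close>. Since \<open>g'\<close> has no zero, \<open>g\<close> is injective by Rolle's theorem and hence
  strictly monotone, so \<open>g c - g t\<close> does not change sign as \<open>t\<close> runs through \<open>[u, v]\<close>: this is where
  it matters that \<open>c\<close> is an endpoint. Therefore \<open>\<integral>\<bar>g c - g t\<bar> dt = \<bar>\<integral>(g c - g t) dt\<bar>\<close>,
  which is the factor in the claimed bound
  (\<open>integral_abs_diff_endpoint\<close>, \<open>endpoint_deviation_le_sup_norm\<close>).

  The same monotonicity makes this factor positive. That covers an infinite supremum, because the
  product of a positive number with \<open>\<infinity>\<close> is \<open>\<infinity>\<close>, whereas \<open>0 * \<infinity> = 0\<close> in the extended reals.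
\<close>

text \<open>
  This is Rolle's theorem for \<open>(f z - f y) * g - (g z - g y) * f\<close>. The endpoints are treated with
  one-sided continuity, since in the application they include \<open>a\<close> and \<open>b\<close>, beyond which \<open>f\<close> and \<open>g\<close>
  are arbitrary.
\<close>

lemma Cauchy_mean_value_differentiable:
  fixes f g :: "real \<Rightarrow> real"
  assumes "y < z"
    and "continuous_on {y..z} f" and "continuous_on {y..z} g"
    and "\<And>t. t \<in> {y<..<z} \<Longrightarrow> f differentiable (at t)"
    and "\<And>t. t \<in> {y<..<z} \<Longrightarrow> g differentiable (at t)"
  obtains t where "t \<in> {y<..<z}" "(f z - f y) * deriv g t = (g z - g y) * deriv f t"
proof -
  define h where "h = (\<lambda>t. (f z - f y) * g t - (g z - g y) * f t)"
  have "\<exists>t>y. t < z \<and> (\<lambda>s. s * ((f z - f y) * deriv g t - (g z - g y) * deriv f t)) = (\<lambda>s. 0)"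
  proof (rule Rolle_deriv[of y z h])
    show "h y = h z" by (simp add: h_def algebra_simps)
    show "continuous_on {y..z} h" unfolding h_def by (intro continuous_intros assms)
    fix t assume t: "y < t" "t < z"
    have "(f has_real_derivative deriv f t) (at t)" "(g has_real_derivative deriv g t) (at t)"
      using assms(4,5)[of t] t by (simp_all add: DERIV_deriv_iff_real_differentiable)
    then have "(h has_real_derivative ((f z - f y) * deriv g t - (g z - g y) * deriv f t)) (at t)"
      unfolding h_def by (auto intro!: derivative_eq_intros)
    then show "(h has_derivative (\<lambda>s. s * ((f z - f y) * deriv g t - (g z - g y) * deriv f t))) (at t)"
      by (rule has_derivative_eq_rhs[OF has_field_derivative_imp_has_derivative]) (simp add: fun_eq_iff)
  qed (use assms in auto)
  then obtain t where t: "t \<in> {y<..<z}"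
    and *: "(\<lambda>s. s * ((f z - f y) * deriv g t - (g z - g y) * deriv f t)) = (\<lambda>s. 0)"
    by auto
  from fun_cong[OF *, of 1] show ?thesis using t that by simp
qed

lemma inj_on_of_deriv_nonzero:
  fixes g :: "real \<Rightarrow> real"
  assumes "continuous_on {u..v} g"
    and "\<And>t. t \<in> {u<..<v} \<Longrightarrow> g differentiable (at t)"
    and "\<And>t. t \<in> {u<..<v} \<Longrightarrow> deriv g t \<noteq> 0"
  shows "inj_on g {u..v}"
proof (rule linorder_inj_onI)
  fix y z assume yz: "y < z" "y \<in> {u..v}" "z \<in> {u..v}"
  show "g y \<noteq> g z"
  proof
    assume eq: "g y = g z"
    \<comment> \<open>Rolle's theorem, as the case of the identity: the derivative of \<open>\<lambda>s. s\<close> is multiplied by \<open>0\<close>.\<close>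
    obtain t where "t \<in> {y<..<z}" "(z - y) * deriv g t = (g z - g y) * deriv (\<lambda>s. s) t"
      by (rule Cauchy_mean_value_differentiable[of y z "\<lambda>s. s" g])
         (use yz assms(2) in \<open>auto intro: continuous_on_subset[OF assms(1)]\<close>)
    with eq yz assms(3)[of t] show False by auto
  qed
qed auto

lemma abs_diff_le_of_abs_deriv_ratio_le:
  fixes f g :: "real \<Rightarrow> real"
  assumes f: "continuous_on {u..v} f" "\<And>t. t \<in> {u<..<v} \<Longrightarrow> f differentiable (at t)"
    and g: "continuous_on {u..v} g" "\<And>t. t \<in> {u<..<v} \<Longrightarrow> g differentiable (at t)"
    and g': "\<And>t. t \<in> {u<..<v} \<Longrightarrow> deriv g t \<noteq> 0"
    and M: "\<And>t. t \<in> {u<..<v} \<Longrightarrow> \<bar>deriv f t / deriv g t\<bar> \<le> M"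
    and "y \<in> {u..v}" "z \<in> {u..v}"
  shows "\<bar>f z - f y\<bar> \<le> M * \<bar>g z - g y\<bar>"
proof -
  have *: "\<bar>f z - f y\<bar> \<le> M * \<bar>g z - g y\<bar>" if yz: "y < z" "y \<in> {u..v}" "z \<in> {u..v}" for y z
  proof -
    obtain t where t: "t \<in> {y<..<z}" and eq: "(f z - f y) * deriv g t = (g z - g y) * deriv f t"
      by (rule Cauchy_mean_value_differentiable[of y z f g])
         (use yz f(2) g(2) in \<open>auto intro: continuous_on_subset[OF f(1)] continuous_on_subset[OF g(1)]\<close>)
    have uv: "t \<in> {u<..<v}" using t yz by auto
    have "f z - f y = deriv f t / deriv g t * (g z - g y)"
      using eq g'[OF uv] by (simp add: field_simps)
    then show ?thesis
      using mult_right_mono[OF M[OF uv], of "\<bar>g z - g y\<bar>"] by (simp add: abs_mult)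
  qed
  consider "y < z" | "y = z" | "z < y" by linarith
  then show ?thesis
    using *[of y z] *[of z y] assms(7,8) by cases (auto simp: abs_minus_commute)
qed

text \<open>
  A continuous injective function is monotone on an interval, so its increments from an endpoint all
  have the same sign, and the absolute value may be pulled out of the integral. The integral is
  nonzero because the increments vanish at the endpoint only.
\<close>

lemma integral_abs_diff_endpoint:
  fixes g :: "real \<Rightarrow> real"
  assumes "u < v" and c: "c = u \<or> c = v"
    and cont: "continuous_on {u..v} g" and inj: "inj_on g {u..v}"
  shows "integral {u..v} (\<lambda>t. \<bar>g c - g t\<bar>) = \<bar>g c * (v - u) - integral {u..v} g\<bar>"
    and "0 < \<bar>g c * (v - u) - integral {u..v} g\<bar>"
proof -
  let ?I = "integral {u..v} (\<lambda>t. \<bar>g c - g t\<bar>)"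
  have cont': "continuous_on {u..v} (\<lambda>t. \<bar>g c - g t\<bar>)"
    by (intro continuous_intros cont)
  have ne: "g u \<noteq> g v" using inj \<open>u < v\<close> by (auto dest: inj_onD)
  have between: "g u < g t \<and> g t < g v \<or> g v < g t \<and> g t < g u" if "u < t" "t < v" for t
    using continuous_inj_imp_mono[OF that cont inj] by simp
  have int: "integral {u..v} (\<lambda>t. g c - g t) = g c * (v - u) - integral {u..v} g"
    using \<open>u < v\<close> cont by (subst integral_diff) (auto intro: integrable_continuous_real)
  have sgn: "(\<forall>t\<in>{u..v}. 0 \<le> g c - g t) \<or> (\<forall>t\<in>{u..v}. g c - g t \<le> 0)"
  proof -
    have "min (g u) (g v) \<le> g t \<and> g t \<le> max (g u) (g v)" if "t \<in> {u..v}" for t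
      using between[of t] that by (cases "t = u"; cases "t = v") auto
    then show ?thesis using c by (cases "g u \<le> g v") fastforce+
  qed
  show eq: "?I = \<bar>g c * (v - u) - integral {u..v} g\<bar>"
    using sgn
  proof
    assume *: "\<forall>t\<in>{u..v}. 0 \<le> g c - g t"
    then have "?I = integral {u..v} (\<lambda>t. g c - g t)"
      by (intro integral_cong) auto
    moreover have "0 \<le> ?I"
      using cont' by (intro integral_nonneg integrable_continuous_real) auto
    ultimately show ?thesis using int by simp
  next
    assume *: "\<forall>t\<in>{u..v}. g c - g t \<le> 0"
    then have "?I = integral {u..v} (\<lambda>t. - (g c - g t))"
      by (intro integral_cong) auto
    also have "\<dots> = - integral {u..v} (\<lambda>t. g c - g t)"
      by (rule integral_neg)
    finally have "?I = - (g c * (v - u) - integral {u..v} g)" using int by simp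
    moreover have "0 \<le> ?I"
      using cont' by (intro integral_nonneg integrable_continuous_real) auto
    ultimately show ?thesis by simp
  qed
  have "?I \<noteq> 0"
  proof
    assume "?I = 0"
    then have "\<forall>t\<in>{u..v}. \<bar>g c - g t\<bar> = 0"
      using cont' \<open>u < v\<close> by (subst (asm) integral_eq_0_iff) auto
    then have "g c = g u" "g c = g v" using \<open>u < v\<close> by auto
    then show False using ne by simp
  qed
  then show "0 < \<bar>g c * (v - u) - integral {u..v} g\<bar>"
    using eq by simp
qed

text \<open>
  Integrating \<open>\<bar>f c - f t\<bar> \<le> M * \<bar>g c - g t\<bar>\<close> over \<open>t\<close> gives the bound on one side of the
  distinguished point. It is left undivided by the length of the interval, so that the two sides
  add up directly.
\<close>

lemma endpoint_deviation_le_sup_norm: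
  fixes f g :: "real \<Rightarrow> real"
  assumes "u < v" and c: "c = u \<or> c = v"
    and f: "continuous_on {u..v} f" "\<And>t. t \<in> {u<..<v} \<Longrightarrow> f differentiable (at t)"
    and g: "continuous_on {u..v} g" "\<And>t. t \<in> {u<..<v} \<Longrightarrow> g differentiable (at t)"
    and g': "\<And>t. t \<in> {u<..<v} \<Longrightarrow> deriv g t \<noteq> 0"
  shows "ereal \<bar>f c * (v - u) - integral {u..v} f\<bar>
    \<le> ereal \<bar>g c * (v - u) - integral {u..v} g\<bar>
        * sup_norm_on {u<..<v} (\<lambda>t. deriv f t / deriv g t)"
proof -
  let ?N = "sup_norm_on {u<..<v} (\<lambda>t. deriv f t / deriv g t)"
  have le_N: "ereal \<bar>deriv f t / deriv g t\<bar> \<le> ?N" if "t \<in> {u<..<v}" for t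
    unfolding sup_norm_on_def by (rule SUP_upper[OF that])
  note deviation_g = integral_abs_diff_endpoint[OF \<open>u < v\<close> c g(1) inj_on_of_deriv_nonzero[OF g g']]
  have "0 \<le> ?N"
    using le_N[of "(u + v) / 2"] \<open>u < v\<close> by (auto intro: order_trans[rotated])
  then consider M where "?N = ereal M" | "?N = \<infinity>" by (cases ?N) auto
  then show ?thesis
  proof cases
    case (1 M)
    have pw: "\<bar>f c - f t\<bar> \<le> M * \<bar>g c - g t\<bar>" if "t \<in> {u..v}" for t
    proof (rule abs_diff_le_of_abs_deriv_ratio_le[OF f g g'])
      show "\<bar>deriv f s / deriv g s\<bar> \<le> M" if "s \<in> {u<..<v}" for s
        using le_N[OF that] 1 by simp
    qed (use that c \<open>u < v\<close> in auto)
    have "f c * (v - u) - integral {u..v} f = integral {u..v} (\<lambda>t. f c - f t)"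
      using \<open>u < v\<close> f(1) by (subst integral_diff) (auto intro: integrable_continuous_real)
    also have "\<bar>\<dots>\<bar> \<le> integral {u..v} (\<lambda>t. M * \<bar>g c - g t\<bar>)"
      unfolding real_norm_def[symmetric]
      by (rule integral_norm_bound_integral)
         (use pw f(1) g(1) in \<open>auto intro!: integrable_continuous_real continuous_intros\<close>)
    also have "\<dots> = M * \<bar>g c * (v - u) - integral {u..v} g\<bar>"
      using deviation_g(1) by simp
    finally show ?thesis using 1 by (simp add: mult.commute)
  next
    case 2
    then show ?thesis using deviation_g(2) by simp
  qed
qed

theorem theorem6:
  fixes a b x :: real and f g :: "real \<Rightarrow> real"
  assumes "a < b"
    and "x \<in> {a<..<b}"
    and "continuous_on {a..b} f"
    and "continuous_on {a..b} g"
    and "\<And>t. t \<in> {a<..<b} - {x} \<Longrightarrow> f differentiable (at t)"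
    and "\<And>t. t \<in> {a<..<b} - {x} \<Longrightarrow> g differentiable (at t)"
    and "\<And>t. t \<in> {a<..<x} \<union> {x<..<b} \<Longrightarrow> deriv g t \<noteq> 0"
  shows "ereal \<bar>f x - 1 / (b - a) * integral {a..b} f\<bar>
    \<le> ereal (1 / (b - a) * \<bar>g x * (x - a) - integral {a..x} g\<bar>)
          * sup_norm_on {a<..<x} (\<lambda>t. deriv f t / deriv g t)
      + ereal (1 / (b - a) * \<bar>g x * (b - x) - integral {x..b} g\<bar>)
          * sup_norm_on {x<..<b} (\<lambda>t. deriv f t / deriv g t)"
proof -
  let ?k = "1 / (b - a)"
  let ?L = "f x * (x - a) - integral {a..x} f" and ?R = "f x * (b - x) - integral {x..b} f"
  let ?GL = "ereal \<bar>g x * (x - a) - integral {a..x} g\<bar>"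
  let ?GR = "ereal \<bar>g x * (b - x) - integral {x..b} g\<bar>"
  let ?NL = "sup_norm_on {a<..<x} (\<lambda>t. deriv f t / deriv g t)"
  let ?NR = "sup_norm_on {x<..<b} (\<lambda>t. deriv f t / deriv g t)"
  have x: "a < x" "x < b" using assms(2) by auto
  have left: "ereal \<bar>?L\<bar> \<le> ?GL * ?NL"
    by (rule endpoint_deviation_le_sup_norm)
       (use x assms(5-7) in \<open>auto intro: continuous_on_subset[OF assms(3)] continuous_on_subset[OF assms(4)]\<close>)
  have right: "ereal \<bar>?R\<bar> \<le> ?GR * ?NR"
    by (rule endpoint_deviation_le_sup_norm)
       (use x assms(5-7) in \<open>auto intro: continuous_on_subset[OF assms(3)] continuous_on_subset[OF assms(4)]\<close>)
  have "integral {a..b} f = integral {a..x} f + integral {x..b} f"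
    using x assms(3) by (subst Henstock_Kurzweil_Integration.integral_combine)
      (auto intro: integrable_continuous_real)
  then have "f x - ?k * integral {a..b} f = ?k * (?L + ?R)"
    using assms(1) by (simp add: field_simps)
  then have "\<bar>f x - ?k * integral {a..b} f\<bar> = ?k * \<bar>?L + ?R\<bar>"
    using assms(1) by (simp add: abs_mult)
  also have "\<dots> \<le> ?k * \<bar>?L\<bar> + ?k * \<bar>?R\<bar>"
    unfolding distrib_left[symmetric]
    by (rule mult_left_mono[OF abs_triangle_ineq]) (use assms(1) in simp)
  finally have "ereal \<bar>f x - ?k * integral {a..b} f\<bar> \<le> ereal ?k * ereal \<bar>?L\<bar> + ereal ?k * ereal \<bar>?R\<bar>"
    by simp
  also have "\<dots> \<le> ereal ?k * (?GL * ?NL) + ereal ?k * (?GR * ?NR)"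
    by (intro add_mono ereal_mult_left_mono left right) (use assms(1) in simp_all)
  finally show ?thesis by (simp only: times_ereal.simps(1)[symmetric] mult.assoc)
qed

end
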